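(* Let $\alpha\in(0,\infty)\setminus\{1\}$ and let $W_1\sim p_1(x_1,y_1)$ and $W_2\sim p_2(x_2,y_2)$ be channels. Then there exist channels $W_1'$ and $W_2'$ with $H^H_\alpha(W_i)=H^A_{1/\alpha}(W_i')$ for $i=1,2$ such that $$H^H_\alpha(W_1)+H^H_\alpha(W_2)=H^A_{1/\alpha}(W_1'\circledast W_2')+H^H_\alpha(W_1\boxplus W_2).$$ More precisely, these channels are given by $$W_i'\sim\bar p_i(x_i,y_i)=\frac{p_i(x_i|y_i)^\alpha\,p_i(y_i)}{\sum_{x,y}p_i(x|y)^\alpha\,p_i(y)},\qquad i=1,2.$$
   Context: For a joint probability distribution $p(x,y)$ on a finite product set, with marginal $p(y)$ and conditional $p(x|y)$, and for $\alpha\in(0,\infty)\setminus\{1\}$, $$H^H_\alpha(X|Y)_p=\frac{1}{1-\alpha}\log\sum_y\sum_x p(y)\,p(x|y)^\alpha,\qquad H^A_\alpha(X|Y)_p=\frac{\alpha}{1-\alpha}\log\sum_y p(y)\Big(\sum_x p(x|y)^\alpha\Big)^{1/\alpha},$$ where terms with $p(y)=0$ are $0$, $0^\alpha=0$, and $\log$ is the natural logarithm. A channel $W\sim p(x,y)$ is identified with a joint distribution of an input $X\in\{0,1\}$ and an output $Y$ in a finite set (the input distribution is part of $p$ and is arbitrary), and $H^*_\alpha(W)=H^*_\alpha(X|Y)_p$ for $*\in\{H,A\}$. Given $W_1\sim p_1(x_1,y_1)$ and $W_2\sim p_2(x_2,y_2)$, let $X_1+X_2$ denote addition modulo 2 (also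 written $\oplus$) and let $$p(z,x_2,y_1,y_2)=p_1(z\oplus x_2,y_1)\,p_2(x_2,y_2)$$ be the joint distribution of $(X_1+X_2,X_2,Y_1,Y_2)$ where $(X_1,Y_1)\sim p_1$ and $(X_2,Y_2)\sim p_2$ are independent. Then $$H^*_\alpha(W_1\boxplus W_2)=H^*_\alpha(X_1+X_2\,|\,Y_1Y_2)_p,\qquad H^*_\alpha(W_1\circledast W_2)=H^*_\alpha(X_2\,|\,X_1+X_2,Y_1Y_2)_p.$$ *)

theory Defs
  imports "HOL-Probability.Probability" "HOL-Library.Numeral_Type"
begin

text \<open>
  Alphabets are finite types, so joint distributions are pmfs on product types and sums range
  over whole types. The conditional probability is \<open>0\<close> when the conditioning event has
  probability \<open>0\<close> (division by zero), and \<open>0 powr a = 0\<close>.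
\<close>

definition marg :: "('x \<times> 'y) pmf \<Rightarrow> 'y \<Rightarrow> real" where
  "marg p y = pmf (map_pmf snd p) y"

definition condp :: "('x \<times> 'y) pmf \<Rightarrow> 'x \<Rightarrow> 'y \<Rightarrow> real" where
  "condp p x y = pmf p (x, y) / marg p y"

definition HH :: "real \<Rightarrow> ('x::finite \<times> 'y::finite) pmf \<Rightarrow> real" where
  "HH \<alpha> p = 1 / (1 - \<alpha>) * ln (\<Sum>y\<in>UNIV. \<Sum>x\<in>UNIV. marg p y * condp p x y powr \<alpha>)"

definition HA :: "real \<Rightarrow> ('x::finite \<times> 'y::finite) pmf \<Rightarrow> real" where
  "HA \<alpha> p = \<alpha> / (1 - \<alpha>) *
     ln (\<Sum>y\<in>UNIV. marg p y * (\<Sum>x\<in>UNIV. condp p x y powr \<alpha>) powr (1 / \<alpha>))"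

text \<open>The input alphabet is the numeral type \<open>2\<close>, the integers modulo 2.\<close>

type_synonym 'y channel = "(2 \<times> 'y) pmf"

text \<open>The law of \<open>(X\<^sub>1 + X\<^sub>2, X\<^sub>2, Y\<^sub>1, Y\<^sub>2)\<close> for independent
  \<open>(X\<^sub>1, Y\<^sub>1)\<close> and \<open>(X\<^sub>2, Y\<^sub>2)\<close>.\<close>

definition combine :: "'y1 channel \<Rightarrow> 'y2 channel \<Rightarrow> (2 \<times> 2 \<times> 'y1 \<times> 'y2) pmf" where
  "combine W1 W2 = map_pmf (\<lambda>((x1, y1), (x2, y2)). (x1 + x2, x2, y1, y2)) (pair_pmf W1 W2)"

lemma two_add_self: "(x::2) + x = 0"
  using exhaust_2[of x] by auto

lemma pmf_combine:
  fixes W1 :: "'y1 channel" and W2 :: "'y2 channel"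
  shows "pmf (combine W1 W2) (z, x2, y1, y2) = pmf W1 (z + x2, y1) * pmf W2 (x2, y2)"
proof -
  let ?f = "\<lambda>((x1, y1), (x2, y2)). (x1 + x2 :: 2, x2 :: 2, y1 :: 'y1, y2 :: 'y2)"
  have inj: "inj ?f" by (auto simp: inj_on_def)
  have "?f ((z + x2, y1), (x2, y2)) = (z, x2, y1, y2)"
    by (simp only: prod.case add.assoc two_add_self add_0_right)
  then show ?thesis
    using pmf_map_inj'[OF inj, of "pair_pmf W1 W2" "((z + x2, y1), (x2, y2))"]
    by (simp only: combine_def pmf_pair)
qed

definition boxplus :: "'y1 channel \<Rightarrow> 'y2 channel \<Rightarrow> ('y1 \<times> 'y2) channel"
    (infixl "\<boxplus>" 65) where
  "W1 \<boxplus> W2 = map_pmf (\<lambda>(z, x2, y1, y2). (z, (y1, y2))) (combine W1 W2)"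

definition circast :: "'y1 channel \<Rightarrow> 'y2 channel \<Rightarrow> (2 \<times> 'y1 \<times> 'y2) channel"
    (infixl "\<circledast>" 65) where
  "W1 \<circledast> W2 = map_pmf (\<lambda>(z, x2, y1, y2). (x2, (z, y1, y2))) (combine W1 W2)"

text \<open>The mass function of the tilted channel \<open>W'\<close>.\<close>

definition tilted :: "real \<Rightarrow> 'y::finite channel \<Rightarrow> 2 \<times> 'y \<Rightarrow> real" where
  "tilted \<alpha> W = (\<lambda>(x, y). condp W x y powr \<alpha> * marg W y /
     (\<Sum>(x', y')\<in>UNIV. condp W x' y' powr \<alpha> * marg W y'))"

end

theory Submission
  imports Defs
begin

text \<open>
  Multiplying out the conditional probabilities turns the inner expression of
  \<open>H\<^sup>A\<close> of order \<open>1/\<alpha>\<close> into \<open>\<Sum>\<^sub>y (\<Sum>\<^sub>x q(x,y)\<^bsup>1/\<alpha>\<^esup>)\<^bsup>\<alpha>\<^esup>\<close>.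
  For a tilted channel the inner exponent \<open>1/\<alpha>\<close> undoes the tilting, so this is
  \<open>1/S\<close> with \<open>S\<close> the normalisation constant of the tilting. For \<open>W\<^sub>1' \<circledast> W\<^sub>2'\<close> the inner sum
  becomes the convolution of the two conditional laws, i.e. the conditional law of
  \<open>W\<^sub>1 \<boxplus> W\<^sub>2\<close>, and the whole expression is \<open>T/(S\<^sub>1 S\<^sub>2)\<close> with \<open>T\<close> the argument of the logarithm
  in \<open>H\<^sup>H(W\<^sub>1 \<boxplus> W\<^sub>2)\<close>. Taking logarithms gives the claim.
\<close>

lemma pmf_map_finite:
  fixes p :: "'a::finite pmf"
  shows "pmf (map_pmf f p) b = (\<Sum>a | f a = b. pmf p a)"
  by (simp add: pmf_map vimage_def measure_measure_pmf_finite)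

lemma marg_eq_sum:
  fixes p :: "('x::finite \<times> 'y::finite) pmf"
  shows "marg p y = (\<Sum>x\<in>UNIV. pmf p (x, y))"
proof -
  have eq: "{a. snd a = y} = (\<lambda>x. (x, y)) ` (UNIV :: 'x set)" by force
  show ?thesis
    unfolding marg_def pmf_map_finite eq by (subst sum.reindex) (auto simp: inj_on_def)
qed

lemma marg_nonneg: "0 \<le> marg p y"
  by (simp add: marg_def)

lemma condp_nonneg: "0 \<le> condp p x y"
  by (simp add: condp_def marg_nonneg)

lemma pmf_le_marg:
  fixes p :: "('x::finite \<times> 'y::finite) pmf"
  shows "pmf p (x, y) \<le> marg p y"
  unfolding marg_eq_sum by (rule member_le_sum) auto

lemma sum_condp:
  fixes p :: "('x::finite \<times> 'y::finite) pmf"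
  assumes "marg p y \<noteq> 0"
  shows "(\<Sum>x\<in>UNIV. condp p x y) = 1"
  using assms by (simp add: condp_def flip: sum_divide_distrib marg_eq_sum)

text \<open>This quantity plays two roles: it is the argument of the logarithm in \<open>HH\<close>,
  and for binary inputs it is the normalisation constant of \<open>tilted\<close>.\<close>

definition tilt_sum :: "real \<Rightarrow> ('x::finite \<times> 'y::finite) pmf \<Rightarrow> real" where
  "tilt_sum \<alpha> p = (\<Sum>y\<in>UNIV. \<Sum>x\<in>UNIV. marg p y * condp p x y powr \<alpha>)"

lemma HH_eq_ln_tilt_sum: "HH \<alpha> p = 1 / (1 - \<alpha>) * ln (tilt_sum \<alpha> p)"
  by (simp add: HH_def tilt_sum_def)

text \<open>All terms are nonnegative, and any atom of \<open>p\<close> contributes a positive one.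
  This licenses dividing by \<open>tilt_sum\<close> and splitting logarithms.\<close>

lemma tilt_sum_pos:
  fixes p :: "('x::finite \<times> 'y::finite) pmf"
  shows "0 < tilt_sum \<alpha> p"
proof -
  obtain x y where "(x, y) \<in> set_pmf p"
    using set_pmf_not_empty[of p] by auto
  then have pos: "0 < pmf p (x, y)"
    by (simp add: pmf_positive)
  then have m: "0 < marg p y"
    using pmf_le_marg[of p x y] by linarith
  have nn: "0 \<le> marg p y' * condp p x' y' powr \<alpha>" for x' y'
    by (simp add: marg_nonneg)
  have "0 < marg p y * condp p x y powr \<alpha>"
    using m pos by (simp add: condp_def)
  also have "\<dots> \<le> (\<Sum>x\<in>UNIV. marg p y * condp p x y powr \<alpha>)"
    by (rule member_le_sum[where f = "\<lambda>x. marg p y * condp p x y powr \<alpha>"]) (auto simp: nn)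
  also have "\<dots> \<le> tilt_sum \<alpha> p"
    unfolding tilt_sum_def
    by (rule member_le_sum[where f = "\<lambda>y. \<Sum>x\<in>UNIV. marg p y * condp p x y powr \<alpha>"])
       (auto simp: nn intro: sum_nonneg)
  finally show ?thesis .
qed

text \<open>Conditioning puts \<open>marg q y powr (1 / \<alpha>)\<close> under the inner sum; the
  outer power \<alpha> turns it into \<open>marg q y\<close>, which cancels the weight.\<close>

lemma HA_inverse_order:
  fixes q :: "('x::finite \<times> 'y::finite) pmf"
  assumes "0 < \<alpha>" "\<alpha> \<noteq> 1"
  shows "HA (1 / \<alpha>) q =
    1 / (\<alpha> - 1) * ln (\<Sum>y\<in>UNIV. (\<Sum>x\<in>UNIV. pmf q (x, y) powr (1 / \<alpha>)) powr \<alpha>)"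
proof -
  have "marg q y * (\<Sum>x\<in>UNIV. condp q x y powr (1 / \<alpha>)) powr \<alpha> =
      (\<Sum>x\<in>UNIV. pmf q (x, y) powr (1 / \<alpha>)) powr \<alpha>" for y
  proof (cases "marg q y = 0")
    case True
    then have "pmf q (x, y) = 0" for x
      using pmf_le_marg[of q x y] pmf_nonneg[of q "(x, y)"] by linarith
    with True show ?thesis by simp
  next
    case False
    then have m: "0 < marg q y" using marg_nonneg[of q y] by linarith
    have "(\<Sum>x\<in>UNIV. condp q x y powr (1 / \<alpha>)) =
        (\<Sum>x\<in>UNIV. pmf q (x, y) powr (1 / \<alpha>)) / marg q y powr (1 / \<alpha>)"
      by (simp add: condp_def powr_divide marg_nonneg sum_divide_distrib)
    with m assms show ?thesis
      by (simp add: powr_divide sum_nonneg powr_powr)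
  qed
  moreover have "1 / \<alpha> / (1 - 1 / \<alpha>) = 1 / (\<alpha> - 1)"
    using assms by (simp add: field_simps)
  ultimately show ?thesis by (simp add: HA_def)
qed

lemma tilted_eq: "tilted \<alpha> W (x, y) = condp W x y powr \<alpha> * marg W y / tilt_sum \<alpha> W"
proof -
  have "(\<Sum>(x', y')\<in>UNIV. condp W x' y' powr \<alpha> * marg W y') = tilt_sum \<alpha> W"
    unfolding tilt_sum_def UNIV_Times_UNIV[symmetric]
    by (subst sum.cartesian_product[symmetric], subst sum.swap) (simp add: mult.commute)
  then show ?thesis by (simp add: tilted_def)
qed

lemma exists_tilted_channel: "\<exists>W'. pmf W' = tilted \<alpha> W"
proof -
  have nn: "0 \<le> tilted \<alpha> W a" for a
    by (cases a) (simp add: tilted_eq marg_nonneg tilt_sum_pos less_imp_le)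
  have "(\<Sum>a\<in>UNIV. tilted \<alpha> W a) = (\<Sum>y\<in>UNIV. \<Sum>x\<in>UNIV. tilted \<alpha> W (x, y))"
    unfolding UNIV_Times_UNIV[symmetric]
    by (subst sum.swap) (simp add: sum.cartesian_product)
  also have "\<dots> = tilt_sum \<alpha> W / tilt_sum \<alpha> W"
    \<comment> \<open>Only the numerator on the right is expanded; the normalising denominator stays
      opaque on both sides.\<close>
    unfolding tilted_eq by (subst (2) tilt_sum_def) (simp add: mult.commute sum_divide_distrib)
  finally have "(\<Sum>a\<in>UNIV. tilted \<alpha> W a) = 1"
    using tilt_sum_pos[of \<alpha> W] by simp
  then have "(\<integral>\<^sup>+a. ennreal (tilted \<alpha> W a) \<partial>count_space UNIV) = 1"
    by (simp add: nn_integral_count_space_finite sum_ennreal nn)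
  then have "pmf (embed_pmf (tilted \<alpha> W)) = tilted \<alpha> W"
    using nn by (intro ext pmf_embed_pmf)
  then show ?thesis by blast
qed

text \<open>The exponents \<alpha> and 1/\<alpha> cancel, so the original conditional law returns to
  first power. The prefactor is free of \<open>x\<close> and can be pulled out of sums over
  inputs.\<close>

lemma tilted_powr_inverse:
  assumes "0 < \<alpha>"
  shows "tilted \<alpha> W (x, y) powr (1 / \<alpha>) =
    (marg W y / tilt_sum \<alpha> W) powr (1 / \<alpha>) * condp W x y"
proof -
  have "tilted \<alpha> W (x, y) = marg W y / tilt_sum \<alpha> W * condp W x y powr \<alpha>"
    by (simp add: tilted_eq)
  then show ?thesis
    using assms by (simp add: powr_mult powr_powr condp_nonneg marg_nonneg
        less_imp_le[OF tilt_sum_pos] del: times_divide_eq_left)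
qed

lemma HA_tilted:
  assumes "0 < \<alpha>" "\<alpha> \<noteq> 1" and W': "pmf W' = tilted \<alpha> W"
  shows "HA (1 / \<alpha>) W' = HH \<alpha> W"
proof -
  let ?S = "tilt_sum \<alpha> W"
  have "(\<Sum>x\<in>UNIV. pmf W' (x, y) powr (1 / \<alpha>)) powr \<alpha> = marg W y / ?S" for y
  proof (cases "marg W y = 0")
    \<comment> \<open>At outputs of probability zero the conditional values are all 0 and do not sum
      to 1, but the prefactor vanishes as well.\<close>
    case True
    then show ?thesis by (simp add: W' tilted_powr_inverse[OF assms(1)])
  next
    case False
    have "(\<Sum>x\<in>UNIV. pmf W' (x, y) powr (1 / \<alpha>)) = (marg W y / ?S) powr (1 / \<alpha>)"
      by (simp add: W' tilted_powr_inverse[OF assms(1)] sum_condp[OF False]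
          flip: sum_distrib_left)
    then show ?thesis
      using assms(1) by (simp add: powr_powr marg_nonneg less_imp_le[OF tilt_sum_pos])
  qed
  moreover have "(\<Sum>y\<in>UNIV. marg W y) = 1"
    unfolding marg_def by (rule sum_pmf_eq_1) auto
  ultimately have "HA (1 / \<alpha>) W' = 1 / (\<alpha> - 1) * ln (1 / ?S)"
    by (simp add: HA_inverse_order[OF assms(1,2)] flip: sum_divide_distrib)
  \<comment> \<open>Two sign changes cancel: one from \<alpha> - 1 against 1 - \<alpha>, one from
    the logarithm of a reciprocal.\<close>
  also have "\<dots> = HH \<alpha> W"
    using assms(2) tilt_sum_pos[of \<alpha> W]
    by (simp add: HH_eq_ln_tilt_sum ln_div field_simps)
  finally show ?thesis .
qed

lemma pmf_circast:
  "pmf (W1 \<circledast> W2) (x2, (z, y1, y2)) = pmf W1 (z + x2, y1) * pmf W2 (x2, y2)"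
proof -
  let ?f = "\<lambda>(z, x2, y1, y2). (x2, (z, y1, y2))"
  have "inj ?f" by (auto simp: inj_on_def)
  from pmf_map_inj'[OF this, of "combine W1 W2" "(z, x2, y1, y2)"] show ?thesis
    by (simp add: circast_def pmf_combine)
qed

lemma pmf_boxplus:
  fixes W1 :: "'y1::finite channel" and W2 :: "'y2::finite channel"
  shows "pmf (W1 \<boxplus> W2) (z, (y1, y2)) = (\<Sum>x2\<in>UNIV. pmf W1 (z + x2, y1) * pmf W2 (x2, y2))"
proof -
  have eq: "{a. (\<lambda>(z, x2, y1, y2). (z, (y1, y2))) a = (z, (y1, y2))} =
      (\<lambda>x2. (z, x2, y1, y2)) ` (UNIV :: 2 set)" by force
  show ?thesis
    unfolding boxplus_def pmf_map_finite eq
    by (subst sum.reindex) (auto simp: inj_on_def pmf_combine)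
qed

text \<open>For fixed \<open>x2\<close>, adding \<open>x2\<close> permutes the inputs, so summing
  over \<open>z\<close> first leaves a factor independent of \<open>x2\<close>.\<close>

lemma marg_boxplus:
  fixes W1 :: "'y1::finite channel" and W2 :: "'y2::finite channel"
  shows "marg (W1 \<boxplus> W2) (y1, y2) = marg W1 y1 * marg W2 y2"
proof -
  have shift: "(\<Sum>z\<in>UNIV. pmf W1 (z + x2, y1)) = marg W1 y1" for x2
    unfolding marg_eq_sum
    by (rule sum.reindex_bij_witness[where i = "\<lambda>z. z - x2" and j = "\<lambda>z. z + x2"]) auto
  show ?thesis
    unfolding marg_eq_sum[of "W1 \<boxplus> W2"] pmf_boxplus
    by (subst sum.swap)
       (simp add: shift marg_eq_sum[of W2] sum_distrib_left flip: sum_distrib_right)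
qed

text \<open>A convolution, since \<open>z + x2\<close> equals \<open>z - x2\<close> modulo 2.
  Outputs of probability zero need no separate case: both sides are 0 there.\<close>

lemma condp_boxplus:
  fixes W1 :: "'y1::finite channel" and W2 :: "'y2::finite channel"
  shows "condp (W1 \<boxplus> W2) z (y1, y2) = (\<Sum>x2\<in>UNIV. condp W1 (z + x2) y1 * condp W2 x2 y2)"
  by (simp add: condp_def pmf_boxplus marg_boxplus sum_divide_distrib)

lemma HA_circast_tilted:
  fixes W1 W1' :: "'y1::finite channel" and W2 W2' :: "'y2::finite channel"
  assumes "0 < \<alpha>" "\<alpha> \<noteq> 1" and W1': "pmf W1' = tilted \<alpha> W1" and W2': "pmf W2' = tilted \<alpha> W2"
  shows "HA (1 / \<alpha>) (W1' \<circledast> W2') = HH \<alpha> W1 + HH \<alpha> W2 - HH \<alpha> (W1 \<boxplus> W2)"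
proof -
  let ?S1 = "tilt_sum \<alpha> W1" and ?S2 = "tilt_sum \<alpha> W2" and ?T = "tilt_sum \<alpha> (W1 \<boxplus> W2)"
  have pos: "0 < ?S1" "0 < ?S2" "0 < ?T" by (rule tilt_sum_pos)+
  have inner: "(\<Sum>x2\<in>UNIV. pmf (W1' \<circledast> W2') (x2, (z, y)) powr (1 / \<alpha>)) powr \<alpha> =
      marg (W1 \<boxplus> W2) y * condp (W1 \<boxplus> W2) z y powr \<alpha> / (?S1 * ?S2)" for z y
  proof (cases y)
    case (Pair y1 y2)
    let ?c1 = "marg W1 y1 / ?S1" and ?c2 = "marg W2 y2 / ?S2"
    have c: "0 \<le> ?c1" "0 \<le> ?c2" using pos by (simp_all add: marg_nonneg)
    have t: "0 \<le> tilted \<alpha> W1 a" "0 \<le> tilted \<alpha> W2 b" for a b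
      unfolding W1'[symmetric] W2'[symmetric] by simp_all
    have "(\<Sum>x2\<in>UNIV. pmf (W1' \<circledast> W2') (x2, (z, y)) powr (1 / \<alpha>)) =
        (\<Sum>x2\<in>UNIV. (?c1 powr (1 / \<alpha>) * ?c2 powr (1 / \<alpha>)) *
          (condp W1 (z + x2) y1 * condp W2 x2 y2))"
      unfolding Pair pmf_circast W1' W2'
      by (intro sum.cong refl)
         (simp add: powr_mult t tilted_powr_inverse[OF assms(1)] mult_ac)
    \<comment> \<open>The sum over \<open>x2\<close>, the input of the left channel, is exactly the
      convolution; \<open>z\<close> changes from part of an output to the input of
      \<open>W1 \<boxplus> W2\<close>.\<close>
    also have "\<dots> = (?c1 * ?c2) powr (1 / \<alpha>) * condp (W1 \<boxplus> W2) z y"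
      unfolding Pair condp_boxplus sum_distrib_left[symmetric] by (simp only: powr_mult c)
    finally show ?thesis
      using assms(1) c pos
      by (simp add: powr_mult powr_powr condp_nonneg Pair marg_boxplus marg_nonneg)
  qed
  \<comment> \<open>Splitting the output of the left channel into \<open>z\<close> and
    \<open>y\<close> produces the double sum in \<open>tilt_sum\<close> of
    \<open>W1 \<boxplus> W2\<close>.\<close>
  have "(\<Sum>zy\<in>UNIV. (\<Sum>x2\<in>UNIV. pmf (W1' \<circledast> W2') (x2, zy) powr (1 / \<alpha>)) powr \<alpha>) =
      (\<Sum>y\<in>UNIV. \<Sum>z\<in>UNIV. (\<Sum>x2\<in>UNIV. pmf (W1' \<circledast> W2') (x2, (z, y)) powr (1 / \<alpha>)) powr \<alpha>)"
    unfolding UNIV_Times_UNIV[symmetric, where ?'a = 2 and ?'b = "'y1 \<times> 'y2"]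
    by (subst sum.swap) (simp add: sum.cartesian_product)
  also have "\<dots> = ?T / (?S1 * ?S2)"
    by (simp add: inner tilt_sum_def[of \<alpha> "W1 \<boxplus> W2"] sum_divide_distrib)
  finally have "HA (1 / \<alpha>) (W1' \<circledast> W2') = 1 / (\<alpha> - 1) * ln (?T / (?S1 * ?S2))"
    by (simp add: HA_inverse_order[OF assms(1,2)])
  also have "\<dots> = HH \<alpha> W1 + HH \<alpha> W2 - HH \<alpha> (W1 \<boxplus> W2)"
  proof -
    have "1 / (\<alpha> - 1) = - (1 / (1 - \<alpha>))"
      using assms(2) by (simp add: field_simps)
    moreover have "ln (?T / (?S1 * ?S2)) = ln ?T - (ln ?S1 + ln ?S2)"
      using pos by (simp add: ln_div ln_mult)
    ultimately show ?thesis
      unfolding HH_eq_ln_tilt_sum by (simp only:) (simp add: algebra_simps)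
  qed
  finally show ?thesis .
qed

theorem mainTheorem2:
  fixes \<alpha> :: real
    and W1 :: "'y1::finite channel"
    and W2 :: "'y2::finite channel"
  assumes "0 < \<alpha>" and "\<alpha> \<noteq> 1"
  shows "\<exists>(W1' :: 'y1 channel) (W2' :: 'y2 channel).
    pmf W1' = tilted \<alpha> W1 \<and>
    pmf W2' = tilted \<alpha> W2 \<and>
    HH \<alpha> W1 = HA (1 / \<alpha>) W1' \<and>
    HH \<alpha> W2 = HA (1 / \<alpha>) W2' \<and>
    HH \<alpha> W1 + HH \<alpha> W2 = HA (1 / \<alpha>) (W1' \<circledast> W2') + HH \<alpha> (W1 \<boxplus> W2)"
proof -
  obtain W1' W2' where W': "pmf W1' = tilted \<alpha> W1" "pmf W2' = tilted \<alpha> W2"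
    using exists_tilted_channel by metis
  show ?thesis
    using HA_tilted[OF assms W'(1)] HA_tilted[OF assms W'(2)] HA_circast_tilted[OF assms W'] W'
    by (intro exI[of _ W1'] exI[of _ W2']) simp
qed

end
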